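(* Let $x\ge0$ and $T\ge1$. Then $$R_3^{\mathrm{AU\text{-}FH}}\le 2\gamma^2(\gamma+\varepsilon_0)^2C_5\left(L_1L_0^2+\frac{2M}{\varepsilon_0^2}\right)\left(\log_2T+1\right).$$
   Context: Setting. $B$ is a standard Brownian motion on a filtered probability space $(\Omega,\mathcal F,\{\mathcal F_t\},\mathbb P)$ (adapted to $\{\mathcal F_t\}$, increments after $t$ independent of $\mathcal F_t$); $\theta<0$, $\sigma>0$, $\gamma:=-2\theta/\sigma^2$; $\underline{\gamma}>0$ is a known constant with $\underline{\gamma}\le\gamma$. Assumption on $h:\mathbb R\to[0,\infty)$: (i) $h$ is continuous; $h$ is strictly increasing on $[0,\infty)$; $h$ is continuously differentiable on $(-\infty,0)$ with $h'(x)<0$ there; (ii) $\lim_{x\to-\infty}h(x)=+\infty$; (iii) there is a constant $0<b<\underline{\gamma}/2$ with $\limsup_{x\to+\infty}h(x)/e^{bx}<+\infty$. Reflected Brownian motion. For $s\ge 0$ and $\mathcal F_s$-measurable (possibly random) $r$ and $y\ge r$, $(Z_r^{s,y},Y_r^{s,y})$ is the unique continuous adapted pair on $[s,\infty)$ with $Z_r^{s,y}(t)=y+\theta(t-s)+\sigma(B(t)-B(s))+Y_r^{s,y}(t)\ge r$, $Y_r^{s,y}$ nondecreasing, $Y_r^{s,y}(s)=0$, $\int_s^t\mathbf 1_{\{Z_r^{s,y}(u)>r\}}\,dY_r^{s,y}(u)=0$ for $t\ge s$. $\mathbb E_x$ is expectation with initial state $x$. Cost. $C(u,r):=u\int_r^\infty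 h(z)e^{-u(z-r)}\,dz$ and $F(u,r):=C(u,r)-h(r)$. For each $u\ge\underline{\gamma}$ the equation $F(u,r)=0$ has a unique solution $r\in\mathbb R$, which is negative; it is denoted $r(u)$. $r^*:=r(\gamma)$; it is the global minimizer of $C(\gamma,\cdot)$. AU-FH algorithm. Let $\tau_k:=2^k-1$, $\Delta\tau_k:=2^k$, $k\ge0$. Set $\tilde r_0:=0$, $\tilde X_0:=x$. Recursively for $k\ge 0$: on $[\tau_k,\tau_{k+1})$ set $Z^{\mathrm{AU\text{-}FH}}(t):=Z^{\tau_k,\tilde X_k}_{\tilde r_k}(t)$; then $\tilde q_{k+1}^{\mathrm{FH}}:=\frac1{\tau_{k+1}}\sum_{i=0}^k\int_{\tau_i}^{\tau_{i+1}}(Z^{\mathrm{AU\text{-}FH}}(s)-\tilde r_i)\,ds$, $\tilde\gamma_{k+1}:=\max\{1/\tilde q_{k+1}^{\mathrm{FH}},\underline{\gamma}\}$, $\tilde r_{k+1}:=r(\tilde\gamma_{k+1})$, $\tilde X_{k+1}:=\max\{Z^{\mathrm{AU\text{-}FH}}(\tau_{k+1}-),\tilde r_{k+1}\}$. Constants (all exist). $K_h>0$ is such that $r(u)\in(-K_h,0)$ for all $u\ge\underline{\gamma}$. $M$ is such that $C(\gamma,r)\le M$ for all $r\in[-K_h,0]$. $\varepsilon_0,\delta_0,L_0>0$ are such that for all $u_1,u_2\in(\gamma-\varepsilon_0,\gamma+\varepsilon_0)\cap[\underline{\gamma},\infty)$, $r(u_1),r(u_2)\in(r^*-\delta_0,r^*+\delta_0)\subseteq(-K_h,0)$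 and $|r(u_1)-r(u_2)|\le L_0|u_1-u_2|$. $L_1$ is such that $0\le C(\gamma,r)-C(\gamma,r^* )\le L_1(r-r^* )^2$ for all $r\in[r^*-\delta_0,r^*+\delta_0]$. $C_5>0$ (depending on $\theta,\sigma,K_h,x$) is such that $\mathbb E_x[(\tilde q_k^{\mathrm{FH}}-1/\gamma)^2]\le C_5/\tau_k$ for all $k\ge1$. Learning regret. For $T\ge1$ let $N:=\lfloor\log_2(T+1)\rfloor$. $R_3^{\mathrm{AU\text{-}FH}}:=\mathbb E_x\big[\sum_{k=1}^N\int_{\tau_k}^{\tau_{k+1}}|C(\gamma,\tilde r_k)-C(\gamma,r^* )|\,dt\big]$. *)

theory Defs
  imports "HOL-Probability.Probability"
begin

section \<open>Brownian motion on a filtered probability space\<close>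

text \<open>
  Time is the type \<^typ>\<open>real\<close>, but processes are constrained only at nonnegative times.
  The library locale \<^locale>\<open>filtration\<close> indexes the filtration by all of \<^typ>\<open>real\<close>; a filtration
  on the half line \<open>[0,\<infinity>)\<close> is of this form after setting \<open>F t = F 0\<close> for \<open>t < 0\<close>.
  Path properties are required almost surely, which includes processes with surely continuous paths.
\<close>

locale standard_brownian_motion = prob_space P + filtration "space P" F
  for P :: "'a measure" and F :: "real \<Rightarrow> 'a measure" +
  fixes B :: "real \<Rightarrow> 'a \<Rightarrow> real"
  assumes filtration_subalgebra: "\<And>t. subalgebra P (F t)"
    and adapted: "\<And>t. 0 \<le> t \<Longrightarrow> B t \<in> borel_measurable (F t)"
    and start: "AE \<omega> in P. B 0 \<omega> = 0"
    and continuous_paths: "AE \<omega> in P. continuous_on {0..} (\<lambda>t. B t \<omega>)"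
    and normal_increments: "\<And>s t. 0 \<le> s \<Longrightarrow> s < t \<Longrightarrow>
      distributed P lborel (\<lambda>\<omega>. B t \<omega> - B s \<omega>) (normal_density 0 (sqrt (t - s)))"
    and indep_increments: "\<And>s t. 0 \<le> s \<Longrightarrow> s < t \<Longrightarrow>
      indep_set (sets (F s)) {(\<lambda>\<omega>. B t \<omega> - B s \<omega>) -` A \<inter> space P | A. A \<in> sets borel}"

section \<open>Reflected Brownian motion\<close>

text \<open>
  \<open>reflected_bm P F B \<theta> \<sigma> s r y Z Y\<close>: the pair \<open>(Z, Y)\<close> is the Brownian motion with drift \<open>\<theta>\<close> and
  volatility \<open>\<sigma>\<close> started at time \<open>s\<close> from \<open>y\<close> and reflected at \<open>r\<close>, together with its regulator.
  The Stieltjes measure \<open>dY\<close> on \<open>[s,\<infinity>)\<close> is the \<^const>\<open>interval_measure\<close> of the path of \<open>Y\<close>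
  continued constantly to the left of \<open>s\<close>. Values of \<open>Z\<close> and \<open>Y\<close> before time \<open>s\<close> are irrelevant.
\<close>

definition reflected_bm ::
  "'a measure \<Rightarrow> (real \<Rightarrow> 'a measure) \<Rightarrow> (real \<Rightarrow> 'a \<Rightarrow> real) \<Rightarrow> real \<Rightarrow> real \<Rightarrow>
   real \<Rightarrow> ('a \<Rightarrow> real) \<Rightarrow> ('a \<Rightarrow> real) \<Rightarrow> (real \<Rightarrow> 'a \<Rightarrow> real) \<Rightarrow> (real \<Rightarrow> 'a \<Rightarrow> real) \<Rightarrow> bool" where
  "reflected_bm P F B \<theta> \<sigma> s r y Z Y \<longleftrightarrow>
     r \<in> borel_measurable (F s) \<and> y \<in> borel_measurable (F s) \<and> (\<forall>\<omega>\<in>space P. r \<omega> \<le> y \<omega>) \<and>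
     (\<forall>t\<ge>s. Z t \<in> borel_measurable (F t) \<and> Y t \<in> borel_measurable (F t)) \<and>
     (AE \<omega> in P.
        continuous_on {s..} (\<lambda>t. Z t \<omega>) \<and> continuous_on {s..} (\<lambda>t. Y t \<omega>) \<and>
        mono_on {s..} (\<lambda>t. Y t \<omega>) \<and> Y s \<omega> = 0 \<and>
        (\<forall>t\<ge>s. Z t \<omega> = y \<omega> + \<theta> * (t - s) + \<sigma> * (B t \<omega> - B s \<omega>) + Y t \<omega> \<and>
               r \<omega> \<le> Z t \<omega> \<and>
               (\<integral>\<^sup>+u\<in>{s..t}. indicator {u. r \<omega> < Z u \<omega>} u
                  \<partial>interval_measure (\<lambda>u. Y (max s u) \<omega>)) = 0))"

section \<open>Holding cost, steady-state cost and optimal threshold\<close>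

definition cost_assumption :: "real \<Rightarrow> (real \<Rightarrow> real) \<Rightarrow> bool" where
  "cost_assumption \<gamma>low h \<longleftrightarrow>
     (\<forall>x. 0 \<le> h x) \<and> continuous_on UNIV h \<and> strict_mono_on {0..} h \<and>
     (\<forall>x<0. h differentiable (at x)) \<and> continuous_on {..<0} (deriv h) \<and> (\<forall>x<0. deriv h x < 0) \<and>
     filterlim h at_top at_bot \<and>
     (\<exists>b. 0 < b \<and> b < \<gamma>low / 2 \<and> Limsup at_top (\<lambda>x. ereal (h x / exp (b * x))) < \<infinity>)"

definition cost_C :: "(real \<Rightarrow> real) \<Rightarrow> real \<Rightarrow> real \<Rightarrow> real" where
  "cost_C h u r = u * (LINT z:{r..}|lborel. h z * exp (- u * (z - r)))"

definition cost_F :: "(real \<Rightarrow> real) \<Rightarrow> real \<Rightarrow> real \<Rightarrow> real" where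
  "cost_F h u r = cost_C h u r - h r"

definition opt_threshold :: "(real \<Rightarrow> real) \<Rightarrow> real \<Rightarrow> real" where
  "opt_threshold h u = (THE r. cost_F h u r = 0)"

section \<open>The AU-FH algorithm\<close>

definition \<tau> :: "nat \<Rightarrow> real" where
  "\<tau> k = 2 ^ k - 1"

text \<open>
  \<open>Z\<close> is the state process under the algorithm, \<open>q\<close> and \<open>g\<close> are the estimates of \<open>1/\<gamma>\<close> and \<open>\<gamma>\<close>
  (their values at \<open>0\<close> are not used), \<open>r\<close> are the thresholds and \<open>X\<close> the states at which the
  episodes start; \<open>x\<close> is the initial state. On the null event where \<open>q (Suc k)\<close> vanishes,
  \<open>1 / q (Suc k) \<omega> = 0\<close>, so that the estimate of \<open>\<gamma>\<close> is \<open>\<gamma>low\<close> there.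
\<close>

locale AU_FH = standard_brownian_motion P F B
  for P :: "'a measure" and F :: "real \<Rightarrow> 'a measure" and B :: "real \<Rightarrow> 'a \<Rightarrow> real" +
  fixes \<theta> \<sigma> \<gamma>low :: real and h :: "real \<Rightarrow> real" and x :: real
    and Z :: "real \<Rightarrow> 'a \<Rightarrow> real" and q g r X :: "nat \<Rightarrow> 'a \<Rightarrow> real"
  assumes initial: "\<And>\<omega>. \<omega> \<in> space P \<Longrightarrow> r 0 \<omega> = 0 \<and> X 0 \<omega> = x"
    and state: "\<And>k. \<exists>Zk Yk. reflected_bm P F B \<theta> \<sigma> (\<tau> k) (r k) (X k) Zk Yk \<and>
      (\<forall>\<omega>\<in>space P. \<forall>t\<in>{\<tau> k..<\<tau> (Suc k)}. Z t \<omega> = Zk t \<omega>)"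
    and q_Suc: "\<And>k \<omega>. \<omega> \<in> space P \<Longrightarrow>
      q (Suc k) \<omega> = 1 / \<tau> (Suc k) * (\<Sum>i=0..k. LINT s:{\<tau> i..<\<tau> (Suc i)}|lborel. Z s \<omega> - r i \<omega>)"
    and g_Suc: "\<And>k \<omega>. \<omega> \<in> space P \<Longrightarrow> g (Suc k) \<omega> = max (1 / q (Suc k) \<omega>) \<gamma>low"
    and r_Suc: "\<And>k \<omega>. \<omega> \<in> space P \<Longrightarrow> r (Suc k) \<omega> = opt_threshold h (g (Suc k) \<omega>)"
    and X_Suc: "\<And>k \<omega>. \<omega> \<in> space P \<Longrightarrow>
      X (Suc k) \<omega> = max (Lim (at_left (\<tau> (Suc k))) (\<lambda>t. Z t \<omega>)) (r (Suc k) \<omega>)"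

text \<open>
  The expectation is the integral of a nonnegative random variable with values in \<open>[0,\<infinity>]\<close>, so
  an upper bound on it includes integrability.
\<close>

definition learning_regret ::
  "'a measure \<Rightarrow> (real \<Rightarrow> real) \<Rightarrow> real \<Rightarrow> (nat \<Rightarrow> 'a \<Rightarrow> real) \<Rightarrow> real \<Rightarrow> ennreal" where
  "learning_regret P h \<gamma> r T =
     (\<integral>\<^sup>+\<omega>. ennreal (\<Sum>k=1..nat \<lfloor>log 2 (T + 1)\<rfloor>.
        LINT t:{\<tau> k..\<tau> (Suc k)}|lborel.
          \<bar>cost_C h \<gamma> (r k \<omega>) - cost_C h \<gamma> (opt_threshold h \<gamma>)\<bar>) \<partial>P)"

end

theory Submission
  imports Defs
begin

text \<open>
  Put \<open>e = \<bar>q k - 1 / \<gamma>\<bar>\<close>. The loss rate of episode \<open>k\<close> is at most a constant times \<open>e\<^sup>2\<close>, path by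
  path. If the estimate \<open>g k\<close> is within \<open>\<epsilon>0\<close> of \<open>\<gamma>\<close>, the cost is quadratic in the threshold near its
  minimizer and the threshold is Lipschitz in the estimate, so the loss rate is at most
  \<open>L1 * L0\<^sup>2 * (g k - \<gamma>)\<^sup>2\<close>. Otherwise it is at most \<open>M\<close>, which is \<open>M / \<epsilon>0\<^sup>2\<close> times the square of
  \<open>min \<bar>g k - \<gamma>\<bar> \<epsilon>0\<close>. Both cases thus reduce to the error of \<open>g k\<close> truncated at \<open>\<epsilon>0\<close>,
  which \<open>truncated_reciprocal_error\<close> bounds by \<open>\<gamma> * (\<gamma> + \<epsilon>0) * e\<close>. The truncation matters since
  the reciprocal is not Lipschitz near \<open>0\<close>.

  By the assumed mean square error, episode \<open>k\<close>, of length \<open>2 ^ k\<close>, then costs at most a constant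
  times \<open>2 ^ k / \<tau> k\<close> in expectation, and this ratio is at most \<open>2\<close>. Hence one bound holds for
  the expected cost of every episode, and their number is at most \<open>log 2 T + 1\<close>.

  Splitting the expectation over the episodes requires the estimates to be measurable. Path
  properties hold only almost surely, so \<open>q k\<close> itself need not be measurable, but it agrees almost
  surely with a random variable (\<open>q_AE_eq_measurable\<close>).
\<close>

section \<open>Time integrals of continuous processes\<close>

text \<open>
  A process that is continuous in time is the limit of its values at the left ends of the
  cells of ever finer grids. Each such discretization takes countably many measurable values, hence is
  jointly measurable, and so is the limit, whose time integral is measurable by Fubini's theorem.
  Off the null set of discontinuous paths the limit is the process itself.
\<close>

lemma set_integral_continuous_paths_AE_eq_measurable:
  fixes W :: "real \<Rightarrow> 'a \<Rightarrow> real"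
  assumes meas: "\<And>t. a \<le> t \<Longrightarrow> W t \<in> borel_measurable M"
    and cont: "AE \<omega> in M. continuous_on {a..} (\<lambda>t. W t \<omega>)"
  shows "\<exists>I\<in>borel_measurable M. AE \<omega> in M. (LINT s:{a..<b}|lborel. W s \<omega>) = I \<omega>"
proof -
  \<comment> \<open>the maximum with \<open>a\<close> keeps the grid point in the range where \<open>W\<close> is measurable and continuous\<close>
  define c where "c n s = max a (real_of_int \<lfloor>real (Suc n) * s\<rfloor> / real (Suc n))" for n s
  define V where "V n = (\<lambda>(\<omega>, s). W (c n s) \<omega>)" for n
  have V_meas: "V n \<in> borel_measurable (M \<Otimes>\<^sub>M lborel)" for n
  proof -
    have "(\<lambda>p. W (max a (real_of_int i / real (Suc n))) (fst p)) \<in> borel_measurable (M \<Otimes>\<^sub>M lborel)"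
      for i
      by (rule measurable_compose[OF measurable_fst]) (simp add: meas)
    moreover have "(\<lambda>p. \<lfloor>real (Suc n) * snd p\<rfloor>) \<in> (M \<Otimes>\<^sub>M lborel) \<rightarrow>\<^sub>M count_space (UNIV :: int set)"
      by measurable
    ultimately have "(\<lambda>p. W (max a (real_of_int \<lfloor>real (Suc n) * snd p\<rfloor> / real (Suc n))) (fst p))
        \<in> borel_measurable (M \<Otimes>\<^sub>M lborel)"
      by (rule measurable_compose_countable)
    then show ?thesis
      by (simp add: V_def c_def case_prod_unfold)
  qed
  define L where "L p = lim (\<lambda>n. V n p)" for p
  have L_meas [measurable]: "L \<in> borel_measurable (M \<Otimes>\<^sub>M lborel)"
    unfolding L_def by (rule borel_measurable_lim_metric) (rule V_meas)
  have c_tendsto: "(\<lambda>n. c n s) \<longlonglongrightarrow> s" if "a \<le> s" for s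
  proof (rule real_tendsto_sandwich)
    have *: "real_of_int \<lfloor>real (Suc n) * s\<rfloor> / real (Suc n) \<in> {s - 1 / real (Suc n)..s}" for n
    proof -
      define d where "d = real (Suc n)"
      have "real_of_int \<lfloor>d * s\<rfloor> \<le> d * s" "d * s - 1 \<le> real_of_int \<lfloor>d * s\<rfloor>" "0 < d"
        by (linarith, linarith, simp add: d_def)
      then have "real_of_int \<lfloor>d * s\<rfloor> / d \<in> {s - 1 / d..s}"
        using divide_right_mono[of "d * s - 1" "real_of_int \<lfloor>d * s\<rfloor>" d]
        by (simp add: diff_divide_distrib pos_divide_le_eq mult.commute)
      then show ?thesis
        by (simp only: d_def)
    qed
    show "\<forall>\<^sub>F n in sequentially. s - 1 / real (Suc n) \<le> c n s"
      using * by (auto simp: c_def le_max_iff_disj simp del: of_nat_Suc)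
    show "\<forall>\<^sub>F n in sequentially. c n s \<le> s"
      using * that by (auto simp: c_def simp del: of_nat_Suc)
    show "(\<lambda>n. s - 1 / real (Suc n)) \<longlonglongrightarrow> s"
      using tendsto_diff[OF tendsto_const LIMSEQ_inverse_real_of_nat, of s]
      by (simp add: inverse_eq_divide del: of_nat_Suc)
  qed simp
  have L_eq: "L (\<omega>, s) = W s \<omega>" if "continuous_on {a..} (\<lambda>t. W t \<omega>)" "a \<le> s" for \<omega> s
  proof -
    have "(\<lambda>n. W (c n s) \<omega>) \<longlonglongrightarrow> W s \<omega>"
      using that c_tendsto[OF that(2)]
      by (intro continuous_on_tendsto_compose[OF that(1)]) (auto simp: c_def)
    then show ?thesis
      by (simp add: L_def V_def limI)
  qed
  show ?thesis
  proof (rule bexI)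
    show "(\<lambda>\<omega>. LINT s|lborel. indicator {a..<b} s * L (\<omega>, s)) \<in> borel_measurable M"
      by measurable
    show "AE \<omega> in M. (LINT s:{a..<b}|lborel. W s \<omega>)
        = (LINT s|lborel. indicator {a..<b} s * L (\<omega>, s))"
      using cont
      by eventually_elim
        (auto simp: set_lebesgue_integral_def L_eq indicator_def intro!: Bochner_Integration.integral_cong)
  qed
qed

section \<open>Estimates and loss rates of the episodes\<close>

lemma (in AU_FH) episode_integral_AE_eq_measurable:
  "\<exists>I\<in>borel_measurable P.
     AE \<omega> in P. (LINT s:{\<tau> i..<\<tau> (Suc i)}|lborel. Z s \<omega> - r i \<omega>) = I \<omega>"
proof -
  obtain Zk Yk where refl: "reflected_bm P F B \<theta> \<sigma> (\<tau> i) (r i) (X i) Zk Yk"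
    and Z_eq: "\<And>\<omega> t. \<omega> \<in> space P \<Longrightarrow> t \<in> {\<tau> i..<\<tau> (Suc i)} \<Longrightarrow> Z t \<omega> = Zk t \<omega>"
    using state[of i] by blast
  have to_P: "f \<in> borel_measurable (F t) \<Longrightarrow> f \<in> borel_measurable P" for f :: "'a \<Rightarrow> real" and t
    using measurable_from_subalg[OF filtration_subalgebra] .
  have "\<exists>I\<in>borel_measurable P.
      AE \<omega> in P. (LINT s:{\<tau> i..<\<tau> (Suc i)}|lborel. Zk s \<omega> - r i \<omega>) = I \<omega>"
  proof (rule set_integral_continuous_paths_AE_eq_measurable)
    show "(\<lambda>\<omega>. Zk t \<omega> - r i \<omega>) \<in> borel_measurable P" if "\<tau> i \<le> t" for t
      using refl that unfolding reflected_bm_def by (intro borel_measurable_diff) (blast intro: to_P)+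
    have "AE \<omega> in P. continuous_on {\<tau> i..} (\<lambda>t. Zk t \<omega>)"
      using refl unfolding reflected_bm_def by auto
    then show "AE \<omega> in P. continuous_on {\<tau> i..} (\<lambda>t. Zk t \<omega> - r i \<omega>)"
      by eventually_elim (intro continuous_intros)
  qed
  moreover have "(LINT s:{\<tau> i..<\<tau> (Suc i)}|lborel. Z s \<omega> - r i \<omega>)
      = (LINT s:{\<tau> i..<\<tau> (Suc i)}|lborel. Zk s \<omega> - r i \<omega>)" if "\<omega> \<in> space P" for \<omega>
    by (rule set_lebesgue_integral_cong) (auto simp: Z_eq that)
  ultimately show ?thesis
    by (simp cong: AE_cong)
qed

lemma (in AU_FH) q_AE_eq_measurable:
  "\<exists>p\<in>borel_measurable P. AE \<omega> in P. q (Suc k) \<omega> = p \<omega>"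
proof -
  have "\<forall>i. \<exists>I. I \<in> borel_measurable P \<and>
      (AE \<omega> in P. (LINT s:{\<tau> i..<\<tau> (Suc i)}|lborel. Z s \<omega> - r i \<omega>) = I \<omega>)"
    using episode_integral_AE_eq_measurable by blast
  from choice[OF this] obtain I where I_meas: "\<And>i. I i \<in> borel_measurable P"
    and I_eq: "\<And>i. AE \<omega> in P. (LINT s:{\<tau> i..<\<tau> (Suc i)}|lborel. Z s \<omega> - r i \<omega>) = I i \<omega>"
    by blast
  show ?thesis
  proof (rule bexI)
    show "(\<lambda>\<omega>. 1 / \<tau> (Suc k) * (\<Sum>i=0..k. I i \<omega>)) \<in> borel_measurable P"
      using I_meas by measurable
    have "AE \<omega> in P. \<forall>i. (LINT s:{\<tau> i..<\<tau> (Suc i)}|lborel. Z s \<omega> - r i \<omega>) = I i \<omega>"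
      using I_eq by (simp add: AE_all_countable)
    then show "AE \<omega> in P. q (Suc k) \<omega> = 1 / \<tau> (Suc k) * (\<Sum>i=0..k. I i \<omega>)"
      using AE_space by eventually_elim (simp add: q_Suc)
  qed
qed

lemma cost_C_nonneg:
  assumes "\<And>x. 0 \<le> h x" and "0 \<le> u"
  shows "0 \<le> cost_C h u \<rho>"
  unfolding cost_C_def set_lebesgue_integral_def
  using assms by (intro mult_nonneg_nonneg integral_nonneg_AE) auto

text \<open>
  If \<open>p > 0\<close>, then \<open>1 / max (1 / p) l = min p (1 / l)\<close>, and truncating at \<open>1 / l \<ge> 1 / c\<close> only
  brings \<open>p\<close> closer to \<open>1 / c\<close>; so the relative error \<open>\<bar>d - c\<bar> / d\<close> of \<open>d = max (1 / p) l\<close> is at most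
  \<open>c * \<bar>p - 1 / c\<bar>\<close>. The relative error increases in \<open>d \<ge> c\<close>, so that for \<open>d \<ge> c + \<epsilon>\<close> it is at
  least \<open>\<epsilon> / (c + \<epsilon>)\<close>. If \<open>p \<le> 0\<close>, then \<open>d = l\<close>, and \<open>c * \<bar>p - 1 / c\<bar> \<ge> 1\<close>, so that the
  right-hand side is at least \<open>c + \<epsilon>\<close>.
\<close>

lemma truncated_reciprocal_error:
  fixes c l p \<epsilon> :: real
  assumes "0 < l" "l \<le> c" "0 < \<epsilon>"
  shows "min \<bar>max (1 / p) l - c\<bar> \<epsilon> \<le> c * (c + \<epsilon>) * \<bar>p - 1 / c\<bar>"
proof (cases "0 < p")
  case False
  define e where "e = \<bar>p - 1 / c\<bar>"
  have c: "0 < c" using assms by simp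
  have "1 / p \<le> l" using False assms divide_nonneg_nonpos[of 1 p] by linarith
  then have d: "max (1 / p) l = l" by (rule max_absorb2)
  have "1 / c \<le> e" using False c by (simp add: e_def)
  then have "1 \<le> c * e" using c by (simp add: field_simps)
  then have "(c + \<epsilon>) * 1 \<le> (c + \<epsilon>) * (c * e)"
    using assms by (intro mult_left_mono) auto
  then show ?thesis
    unfolding d e_def[symmetric] using assms by (auto simp: min_def algebra_simps)
next
  case True
  define d where "d = max (1 / p) l"
  define e where "e = \<bar>p - 1 / c\<bar>"
  have c: "0 < c" and d: "0 < d" using assms by (simp_all add: d_def)
  have inv: "1 / d = min p (1 / l)"
    using True assms by (auto simp: d_def max_def min_def field_simps)
  have "\<bar>1 / d - 1 / c\<bar> \<le> e"
  proof -
    have "1 / c \<le> 1 / l" using assms by (simp add: frac_le)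
    then show ?thesis unfolding inv e_def by (auto simp: min_def)
  qed
  moreover have "\<bar>d - c\<bar> = d * c * \<bar>1 / d - 1 / c\<bar>"
  proof -
    have "d - c = - (d * c * (1 / d - 1 / c))"
      using c d by (simp add: field_simps)
    then show ?thesis using c d by (simp add: abs_mult)
  qed
  ultimately have rel: "\<bar>d - c\<bar> \<le> d * (c * e)"
    using c d by (simp add: mult.assoc mult_left_mono)
  have e: "0 \<le> c * e" using c by (simp add: e_def)
  have "min \<bar>d - c\<bar> \<epsilon> \<le> (c + \<epsilon>) * (c * e)"
  proof (cases "d \<le> c + \<epsilon>")
    case True
    then show ?thesis using rel mult_right_mono[OF True e] by linarith
  next
    case False
    have "d * \<epsilon> \<le> (c + \<epsilon>) * (d - c)"
    proof -
      have "0 \<le> c * (d - (c + \<epsilon>))" using False c by simp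
      then show ?thesis by (simp add: algebra_simps)
    qed
    also have "\<dots> \<le> (c + \<epsilon>) * (d * (c * e))"
      using rel c assms by (intro mult_left_mono) auto
    finally have "d * \<epsilon> \<le> d * ((c + \<epsilon>) * (c * e))" by (simp add: ac_simps)
    then show ?thesis using d by simp
  qed
  then show ?thesis by (simp add: d_def e_def ac_simps)
qed

text \<open>
  The loss is quadratic in \<open>\<bar>v - c\<bar>\<close> as long as this is below \<open>\<epsilon>\<close> and bounded beyond. Here \<open>f\<close>
  stands for the cost as a function of the threshold, and \<open>R\<close> for the map from estimates to
  thresholds.
\<close>

lemma loss_le_truncated_square:
  fixes f R :: "real \<Rightarrow> real" and c v l \<epsilon> \<delta> L L' M :: real
  assumes near: "\<bar>v - c\<bar> < \<epsilon> \<Longrightarrow> \<bar>R v - R c\<bar> < \<delta> \<and> \<bar>R v - R c\<bar> \<le> L * \<bar>v - c\<bar>"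
    and quad: "\<And>\<rho>. \<bar>\<rho> - R c\<bar> \<le> \<delta> \<Longrightarrow> 0 \<le> f \<rho> - f (R c) \<and> f \<rho> - f (R c) \<le> L' * (\<rho> - R c)\<^sup>2"
    and bound: "f (R v) \<in> {0..M}" "f (R c) \<in> {0..M}"
    and pos: "0 < \<epsilon>" "0 < \<delta>" "0 < L"
  shows "\<bar>f (R v) - f (R c)\<bar> \<le> (L' * L\<^sup>2 + M / \<epsilon>\<^sup>2) * (min \<bar>v - c\<bar> \<epsilon>)\<^sup>2"
proof -
  have L': "0 \<le> L'"
  proof -
    have "0 \<le> L' * \<delta>\<^sup>2" using quad[of "R c + \<delta>"] pos by simp
    then show ?thesis using pos by (simp add: zero_le_mult_iff)
  qed
  have M: "0 \<le> M" using bound by auto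
  show ?thesis
  proof (cases "\<bar>v - c\<bar> < \<epsilon>")
    case True
    have "\<bar>f (R v) - f (R c)\<bar> \<le> L' * \<bar>R v - R c\<bar>\<^sup>2"
      using quad[of "R v"] near[OF True] by simp
    also have "\<dots> \<le> L' * (L * \<bar>v - c\<bar>)\<^sup>2"
      using near[OF True] L' by (intro mult_left_mono power_mono) auto
    also have "\<dots> \<le> (L' * L\<^sup>2 + M / \<epsilon>\<^sup>2) * \<bar>v - c\<bar>\<^sup>2"
      using M by (simp add: power_mult_distrib algebra_simps)
    finally show ?thesis using True by (simp add: min_def)
  next
    case False
    have "\<bar>f (R v) - f (R c)\<bar> \<le> M" using bound by auto
    also have "\<dots> \<le> (L' * L\<^sup>2 + M / \<epsilon>\<^sup>2) * \<epsilon>\<^sup>2"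
      using L' pos by (simp add: distrib_right)
    finally show ?thesis using False by (simp add: min_def)
  qed
qed

section \<open>Summation over the episodes\<close>

lemma \<tau>_diff: "\<tau> (Suc k) - \<tau> k = 2 ^ k"
  by (simp add: \<tau>_def)

lemma episode_length_over_start_le:
  assumes "1 \<le> k"
  shows "2 ^ k / \<tau> k \<le> 2"
proof -
  have "(2::real) ^ 1 \<le> 2 ^ k" using assms by (intro power_increasing) auto
  then show ?thesis by (simp add: \<tau>_def field_simps)
qed

lemma number_of_episodes_le:
  fixes T :: real
  assumes "1 \<le> T"
  shows "real (nat \<lfloor>log 2 (T + 1)\<rfloor>) \<le> log 2 T + 1"
proof -
  have "log 2 (T + 1) \<le> log 2 (2 * T)" using assms by simp
  also have "\<dots> = log 2 T + 1" using assms by (simp add: log_mult)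
  finally show ?thesis using assms by (simp add: of_nat_nat) linarith
qed

text \<open>
  The loss rate is constant during an episode, so its time integral is the rate times \<open>2 ^ k\<close>. The
  expected loss of every episode is at most \<open>2 * A * D\<close>.
\<close>

lemma (in AU_FH) learning_regret_le:
  assumes A: "0 \<le> A"
    and rate: "\<And>k \<omega>. \<omega> \<in> space P \<Longrightarrow> 1 \<le> k \<Longrightarrow>
      \<bar>cost_C h \<gamma> (r k \<omega>) - cost_C h \<gamma> (opt_threshold h \<gamma>)\<bar> \<le> A * (q k \<omega> - m)\<^sup>2"
    and D: "0 \<le> D"
    and mse: "\<And>k. 1 \<le> k \<Longrightarrow> (\<integral>\<^sup>+\<omega>. ennreal ((q k \<omega> - m)\<^sup>2) \<partial>P) \<le> ennreal (D / \<tau> k)"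
  shows "learning_regret P h \<gamma> r T \<le> ennreal (2 * A * D * real (nat \<lfloor>log 2 (T + 1)\<rfloor>))"
proof -
  define N where "N = nat \<lfloor>log 2 (T + 1)\<rfloor>"
  obtain p where p_meas: "\<And>k. p (Suc k) \<in> borel_measurable P"
    and p_eq: "\<And>k. AE \<omega> in P. q (Suc k) \<omega> = p (Suc k) \<omega>"
  proof -
    obtain p' where "\<And>k. p' k \<in> borel_measurable P" "\<And>k. AE \<omega> in P. q (Suc k) \<omega> = p' k \<omega>"
      using q_AE_eq_measurable by metis
    then show thesis by (intro that[of "\<lambda>k. p' (k - 1)"]) auto
  qed
  have p_meas': "p k \<in> borel_measurable P" and p_eq': "AE \<omega> in P. q k \<omega> = p k \<omega>" if "1 \<le> k" for k
    using p_meas[of "k - 1"] p_eq[of "k - 1"] that by simp_all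
  have "learning_regret P h \<gamma> r T
      \<le> (\<integral>\<^sup>+\<omega>. ennreal (\<Sum>k=1..N. 2 ^ k * (A * (q k \<omega> - m)\<^sup>2)) \<partial>P)"
    unfolding learning_regret_def N_def[symmetric]
  proof (intro nn_integral_mono ennreal_leI sum_mono)
    fix \<omega> k assume "\<omega> \<in> space P" "k \<in> {1..N}"
    moreover have "\<tau> k \<le> \<tau> (Suc k)" by (simp add: \<tau>_def)
    ultimately show "(LINT t:{\<tau> k..\<tau> (Suc k)}|lborel.
          \<bar>cost_C h \<gamma> (r k \<omega>) - cost_C h \<gamma> (opt_threshold h \<gamma>)\<bar>) \<le> 2 ^ k * (A * (q k \<omega> - m)\<^sup>2)"
      using rate[of \<omega> k] by (simp add: set_integral_const \<tau>_diff)
  qed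
  also have "\<dots> = (\<integral>\<^sup>+\<omega>. (\<Sum>k=1..N. ennreal (2 ^ k * A) * ennreal ((p k \<omega> - m)\<^sup>2)) \<partial>P)"
  proof (rule nn_integral_cong_AE)
    have "AE \<omega> in P. \<forall>k\<in>{1..N}. q k \<omega> = p k \<omega>"
      using p_eq' by (intro AE_finite_allI) auto
    then show "AE \<omega> in P. ennreal (\<Sum>k=1..N. 2 ^ k * (A * (q k \<omega> - m)\<^sup>2))
        = (\<Sum>k=1..N. ennreal (2 ^ k * A) * ennreal ((p k \<omega> - m)\<^sup>2))"
    proof eventually_elim
      case (elim \<omega>)
      have "ennreal (\<Sum>k=1..N. 2 ^ k * (A * (q k \<omega> - m)\<^sup>2))
          = (\<Sum>k=1..N. ennreal (2 ^ k * (A * (q k \<omega> - m)\<^sup>2)))"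
        using A by (intro sum_ennreal[symmetric]) simp
      also have "\<dots> = (\<Sum>k=1..N. ennreal (2 ^ k * A) * ennreal ((p k \<omega> - m)\<^sup>2))"
        using A elim by (intro sum.cong refl) (simp add: ennreal_mult[symmetric] mult.assoc)
      finally show ?case .
    qed
  qed
  also have "\<dots> = (\<Sum>k=1..N. ennreal (2 ^ k * A) * (\<integral>\<^sup>+\<omega>. ennreal ((p k \<omega> - m)\<^sup>2) \<partial>P))"
    proof (subst nn_integral_sum)
    show "(\<lambda>\<omega>. ennreal (2 ^ k * A) * ennreal ((p k \<omega> - m)\<^sup>2)) \<in> borel_measurable P" if "k \<in> {1..N}" for k
    proof -
      have [measurable]: "p k \<in> borel_measurable P" using p_meas' that by simp
      show ?thesis by measurable
    qed
    show "(\<Sum>k=1..N. \<integral>\<^sup>+\<omega>. ennreal (2 ^ k * A) * ennreal ((p k \<omega> - m)\<^sup>2) \<partial>P)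
        = (\<Sum>k=1..N. ennreal (2 ^ k * A) * (\<integral>\<^sup>+\<omega>. ennreal ((p k \<omega> - m)\<^sup>2) \<partial>P))"
    proof (intro sum.cong refl nn_integral_cmult)
      show "(\<lambda>\<omega>. ennreal ((p k \<omega> - m)\<^sup>2)) \<in> borel_measurable P" if "k \<in> {1..N}" for k
      proof -
        have [measurable]: "p k \<in> borel_measurable P" using p_meas' that by simp
        show ?thesis by measurable
      qed
    qed
  qed
  also have "\<dots> \<le> (\<Sum>k=1..N. ennreal (2 * A * D))"
  proof (rule sum_mono)
    fix k assume k: "k \<in> {1..N}"
    have "(\<integral>\<^sup>+\<omega>. ennreal ((p k \<omega> - m)\<^sup>2) \<partial>P) = (\<integral>\<^sup>+\<omega>. ennreal ((q k \<omega> - m)\<^sup>2) \<partial>P)"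
      using p_eq'[of k] k by (intro nn_integral_cong_AE) auto
    also have "\<dots> \<le> ennreal (D / \<tau> k)" using mse k by simp
    finally have "ennreal (2 ^ k * A) * (\<integral>\<^sup>+\<omega>. ennreal ((p k \<omega> - m)\<^sup>2) \<partial>P)
        \<le> ennreal (2 ^ k * A) * ennreal (D / \<tau> k)"
      by (intro mult_left_mono) auto
    also have "\<dots> = ennreal (2 ^ k / \<tau> k * (A * D))"
      using A D by (subst ennreal_mult[symmetric]) (auto simp: \<tau>_def)
    also have "\<dots> \<le> ennreal (2 * A * D)"
      using mult_right_mono[OF episode_length_over_start_le[of k], of "A * D"] A D k
      by (intro ennreal_leI) (simp add: mult.assoc)
    finally show "ennreal (2 ^ k * A) * (\<integral>\<^sup>+\<omega>. ennreal ((p k \<omega> - m)\<^sup>2) \<partial>P) \<le> ennreal (2 * A * D)" .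
  qed
  also have "\<dots> = ennreal (2 * A * D * real N)"
    using A D by (simp add: ennreal_of_nat_eq_real_of_nat ennreal_mult[symmetric] mult.commute)
  finally show ?thesis unfolding N_def .
qed

theorem proposition8:
  fixes P :: "'a measure" and F :: "real \<Rightarrow> 'a measure" and B :: "real \<Rightarrow> 'a \<Rightarrow> real"
    and \<theta> \<sigma> \<gamma> \<gamma>low x T :: real and h :: "real \<Rightarrow> real"
    and Z :: "real \<Rightarrow> 'a \<Rightarrow> real" and q g r X :: "nat \<Rightarrow> 'a \<Rightarrow> real"
    and Kh M \<epsilon>0 \<delta>0 L0 L1 C5 :: real
  assumes "\<theta> < 0" and "0 < \<sigma>" and "\<gamma> = - 2 * \<theta> / \<sigma>\<^sup>2"
    and "0 < \<gamma>low" and "\<gamma>low \<le> \<gamma>"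
    and "cost_assumption \<gamma>low h"
    and "0 \<le> x" and "1 \<le> T"
    and "AU_FH P F B \<theta> \<sigma> \<gamma>low h x Z q g r X"
    and "0 < Kh" and "\<forall>u\<ge>\<gamma>low. opt_threshold h u \<in> {-Kh<..<0}"
    and "\<forall>\<rho>\<in>{-Kh..0}. cost_C h \<gamma> \<rho> \<le> M"
    and "0 < \<epsilon>0" and "0 < \<delta>0" and "0 < L0"
    and "{opt_threshold h \<gamma> - \<delta>0<..<opt_threshold h \<gamma> + \<delta>0} \<subseteq> {-Kh<..<0}"
    and "\<forall>u1\<in>{\<gamma> - \<epsilon>0<..<\<gamma> + \<epsilon>0} \<inter> {\<gamma>low..}. \<forall>u2\<in>{\<gamma> - \<epsilon>0<..<\<gamma> + \<epsilon>0} \<inter> {\<gamma>low..}.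
           opt_threshold h u1 \<in> {opt_threshold h \<gamma> - \<delta>0<..<opt_threshold h \<gamma> + \<delta>0} \<and>
           opt_threshold h u2 \<in> {opt_threshold h \<gamma> - \<delta>0<..<opt_threshold h \<gamma> + \<delta>0} \<and>
           \<bar>opt_threshold h u1 - opt_threshold h u2\<bar> \<le> L0 * \<bar>u1 - u2\<bar>"
    and "\<forall>\<rho>\<in>{opt_threshold h \<gamma> - \<delta>0..opt_threshold h \<gamma> + \<delta>0}.
           0 \<le> cost_C h \<gamma> \<rho> - cost_C h \<gamma> (opt_threshold h \<gamma>) \<and>
           cost_C h \<gamma> \<rho> - cost_C h \<gamma> (opt_threshold h \<gamma>) \<le> L1 * (\<rho> - opt_threshold h \<gamma>)\<^sup>2"
    and "0 < C5"
    and "\<forall>k\<ge>1. (\<integral>\<^sup>+\<omega>. ennreal ((q k \<omega> - 1 / \<gamma>)\<^sup>2) \<partial>P) \<le> ennreal (C5 / \<tau> k)"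
  shows "learning_regret P h \<gamma> r T \<le>
    ennreal (2 * \<gamma>\<^sup>2 * (\<gamma> + \<epsilon>0)\<^sup>2 * C5 * (L1 * L0\<^sup>2 + 2 * M / \<epsilon>0\<^sup>2) * (log 2 T + 1))"
proof -
  interpret AU_FH P F B \<theta> \<sigma> \<gamma>low h x Z q g r X by fact
  let ?R = "opt_threshold h" and ?f = "cost_C h \<gamma>"
  have \<gamma>: "0 < \<gamma>" using assms(4,5) by simp
  have f_nonneg: "0 \<le> ?f \<rho>" for \<rho>
    using assms(6) \<gamma> by (intro cost_C_nonneg) (auto simp: cost_assumption_def)
  have f_bound: "?f (?R u) \<in> {0..M}" if "\<gamma>low \<le> u" for u
    using assms(11,12) that f_nonneg by fastforce
  have M: "0 \<le> M" using f_bound[OF assms(5)] by auto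
  have quad: "0 \<le> ?f \<rho> - ?f (?R \<gamma>) \<and> ?f \<rho> - ?f (?R \<gamma>) \<le> L1 * (\<rho> - ?R \<gamma>)\<^sup>2"
    if "\<bar>\<rho> - ?R \<gamma>\<bar> \<le> \<delta>0" for \<rho>
    using assms(18) that by (auto simp: abs_le_iff)
  have L1: "0 \<le> L1"
  proof -
    have "0 \<le> L1 * \<delta>0\<^sup>2" using quad[of "?R \<gamma> + \<delta>0"] assms(14) by simp
    then show ?thesis using assms(14) by (simp add: zero_le_mult_iff)
  qed
  define K where "K = L1 * L0\<^sup>2 + M / \<epsilon>0\<^sup>2"
  have K: "0 \<le> K" using L1 M by (simp add: K_def)
  have rate: "\<bar>?f (r k \<omega>) - ?f (?R \<gamma>)\<bar> \<le> K * (\<gamma> * (\<gamma> + \<epsilon>0))\<^sup>2 * (q k \<omega> - 1 / \<gamma>)\<^sup>2"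
    if \<omega>: "\<omega> \<in> space P" and "1 \<le> k" for k \<omega>
  proof -
    obtain j where k: "k = Suc j" using \<open>1 \<le> k\<close> by (cases k) auto
    define v where "v = max (1 / q k \<omega>) \<gamma>low"
    have v: "\<gamma>low \<le> v" by (simp add: v_def)
    have "\<bar>?f (?R v) - ?f (?R \<gamma>)\<bar> \<le> K * (min \<bar>v - \<gamma>\<bar> \<epsilon>0)\<^sup>2"
      unfolding K_def
    proof (rule loss_le_truncated_square[where f = ?f and R = ?R and \<delta> = \<delta>0 and L = L0])
      show "\<bar>?R v - ?R \<gamma>\<bar> < \<delta>0 \<and> \<bar>?R v - ?R \<gamma>\<bar> \<le> L0 * \<bar>v - \<gamma>\<bar>" if "\<bar>v - \<gamma>\<bar> < \<epsilon>0"
      proof -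
        have "v \<in> {\<gamma> - \<epsilon>0<..<\<gamma> + \<epsilon>0} \<inter> {\<gamma>low..}" "\<gamma> \<in> {\<gamma> - \<epsilon>0<..<\<gamma> + \<epsilon>0} \<inter> {\<gamma>low..}"
          using that v assms(5,13) by auto
        from assms(17)[rule_format, OF this] show ?thesis by auto
      qed
    qed (use quad f_bound[OF v] f_bound[OF assms(5)] assms(13-15) in \<open>blast+\<close>)
    also have "\<dots> \<le> K * (\<gamma> * (\<gamma> + \<epsilon>0) * \<bar>q k \<omega> - 1 / \<gamma>\<bar>)\<^sup>2"
      using K assms(13) truncated_reciprocal_error[OF assms(4,5,13), of "q k \<omega>"]
      by (intro mult_left_mono power_mono) (auto simp: v_def)
    finally show ?thesis
      using \<omega> by (simp add: k r_Suc g_Suc v_def power_mult_distrib mult.assoc)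
  qed
  have "learning_regret P h \<gamma> r T
      \<le> ennreal (2 * (K * (\<gamma> * (\<gamma> + \<epsilon>0))\<^sup>2) * C5 * real (nat \<lfloor>log 2 (T + 1)\<rfloor>))"
    using K rate assms(19,20) by (intro learning_regret_le) auto
  also have "\<dots> \<le> ennreal (2 * \<gamma>\<^sup>2 * (\<gamma> + \<epsilon>0)\<^sup>2 * C5 * (L1 * L0\<^sup>2 + 2 * M / \<epsilon>0\<^sup>2) * (log 2 T + 1))"
  proof (rule ennreal_leI)
    have "K \<le> L1 * L0\<^sup>2 + 2 * M / \<epsilon>0\<^sup>2"
      using M by (simp add: K_def divide_right_mono)
    then have "2 * \<gamma>\<^sup>2 * (\<gamma> + \<epsilon>0)\<^sup>2 * C5 * K * real (nat \<lfloor>log 2 (T + 1)\<rfloor>)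
        \<le> 2 * \<gamma>\<^sup>2 * (\<gamma> + \<epsilon>0)\<^sup>2 * C5 * (L1 * L0\<^sup>2 + 2 * M / \<epsilon>0\<^sup>2) * (log 2 T + 1)"
      using K assms(19) number_of_episodes_le[OF assms(8)]
      by (intro mult_mono mult_left_mono mult_nonneg_nonneg) auto
    then show "2 * (K * (\<gamma> * (\<gamma> + \<epsilon>0))\<^sup>2) * C5 * real (nat \<lfloor>log 2 (T + 1)\<rfloor>)
        \<le> 2 * \<gamma>\<^sup>2 * (\<gamma> + \<epsilon>0)\<^sup>2 * C5 * (L1 * L0\<^sup>2 + 2 * M / \<epsilon>0\<^sup>2) * (log 2 T + 1)"
      by (simp add: power_mult_distrib ac_simps)
  qed
  finally show ?thesis .
qed

end
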